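(* Let $p_1$, $p_2$, $\tilde p_1$ and $\tilde p_2$ be four finite real numbers such that $[p_1,p_2]\subset(\tilde p_1,\tilde p_2)$. Suppose that $\psi\in\mathcal C^2(\mathbb R,\mathbb R)$ is a concave function such that $|\psi'|>0$ on $[p_1,p_2]$. Assume that $U\in\mathcal C^1(\mathbb R,\mathbb C)$ satisfies $\mathrm{supp}\,U\subseteq[p_1,p_2]$. Then for all $\omega>0$, $$\left|\int_{\mathbb R}U(p)\,e^{i\omega\psi(p)}\,dp\right|\leqslant\Big(C_3(\psi,p_1,p_2)\,\|U'\|_{L^2(\mathbb R)}+C_4(\psi,p_1,p_2)\,\|U\|_{L^\infty(\mathbb R)}\Big)\,\omega^{-1},$$ where $$C_3(\psi,p_1,p_2)=(p_2-p_1)^{\frac12}\min\{|\psi'(p_1)|,|\psi'(p_2)|\}^{-1},\qquad C_4(\psi,p_1,p_2)=\min\{|\psi'(p_1)|,|\psi'(p_2)|\}^{-1}.$$ *)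

theory Defs
  imports "HOL-Analysis.Analysis" "HOL-Probability.Essential_Supremum"
begin

definition C2_function :: "(real \<Rightarrow> real) \<Rightarrow> bool" where
  "C2_function \<psi> \<longleftrightarrow>
     \<psi> C1_differentiable_on UNIV \<and> deriv \<psi> C1_differentiable_on UNIV"

definition closed_support :: "(real \<Rightarrow> complex) \<Rightarrow> real set" where
  "closed_support f = closure {x. f x \<noteq> 0}"

text \<open>The norms below are real-valued, so they are meaningful only for square-integrable,
  respectively essentially bounded, functions.  Continuous functions with compact support
  (such as a compactly supported continuously differentiable function and its derivative)
  satisfy both conditions.\<close>

definition L2_norm :: "(real \<Rightarrow> complex) \<Rightarrow> real" where
  "L2_norm f = sqrt (LINT x|lborel. (norm (f x))\<^sup>2)"

definition Linf_norm :: "(real \<Rightarrow> complex) \<Rightarrow> real" where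
  "Linf_norm f = real_of_ereal (esssup lborel (\<lambda>x. ereal (norm (f x))))"

definition C3 :: "(real \<Rightarrow> real) \<Rightarrow> real \<Rightarrow> real \<Rightarrow> real" where
  "C3 \<psi> p1 p2 = (p2 - p1) powr (1/2) * inverse (min \<bar>deriv \<psi> p1\<bar> \<bar>deriv \<psi> p2\<bar>)"

definition C4 :: "(real \<Rightarrow> real) \<Rightarrow> real \<Rightarrow> real \<Rightarrow> real" where
  "C4 \<psi> p1 p2 = inverse (min \<bar>deriv \<psi> p1\<bar> \<bar>deriv \<psi> p2\<bar>)"

end

theory Submission imports Defs begin

text \<open>
  Since \<open>\<psi>'\<close> does not vanish on the support of \<open>U\<close>, the factor \<open>e\<^sup>i\<^sup>\<omega>\<^sup>\<psi>\<close> equals there its own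
  derivative divided by \<open>\<i>\<omega>\<psi>'\<close>, and one integration by parts gains the factor \<open>1/\<omega>\<close>:
  \<open>\<integral> U e\<^sup>i\<^sup>\<omega>\<^sup>\<psi> = - (1 / \<i>\<omega>) \<integral> (U / \<psi>')' e\<^sup>i\<^sup>\<omega>\<^sup>\<psi>\<close>, where the boundary terms are zero because the
  continuous function \<open>U\<close> vanishes at both ends of an interval that contains its support. It
  remains to estimate the two parts of \<open>(U / \<psi>')' = U' / \<psi>' - U \<psi>'' / \<psi>'\<^sup>2\<close>.

  Concavity enters twice. First, \<open>\<psi>'\<close> is nonincreasing and of one sign, so \<open>\<bar>\<psi>'\<bar>\<close> is at least its
  smaller endpoint value \<open>m\<close>; this bounds the first part by \<open>\<integral>\<bar>U'\<bar> / m\<close>, and the Cauchy-Schwarz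
  inequality turns \<open>\<integral>\<bar>U'\<bar>\<close> into the square root of the length times the \<open>L\<^sup>2\<close> norm. Secondly,
  \<open>\<psi>''\<close> has a constant sign, so \<open>\<bar>\<psi>'' / \<psi>'\<^sup>2\<bar>\<close> is exactly the derivative of \<open>1 / \<psi>'\<close>. Its integral
  is therefore a difference of two endpoint values of \<open>1 / \<psi>'\<close>, which have the same sign, and is
  at most \<open>1 / m\<close> without any reference to the size of \<open>\<psi>''\<close>.

  The interval estimate is \<open>norm_oscillatory_integral_le\<close>; \<open>integral_norm_le_L2_norm\<close> and
  \<open>norm_le_Linf_norm\<close> relate the quantities in it to the norms of the conclusion.
\<close>

section \<open>Slopes of concave functions\<close>

text \<open>
  The graph of a concave function lies below its tangents. Adding the tangent inequality at \<open>x\<close>,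
  evaluated at \<open>y\<close>, to the one at \<open>y\<close>, evaluated at \<open>x\<close>, cancels the values of \<open>f\<close> and leaves
  a comparison of the slopes.
\<close>
lemma concave_on_deriv_antimono:
  fixes f :: "real \<Rightarrow> real"
  assumes "concave_on A f" and "connected A"
    and x: "x \<in> interior A" and y: "y \<in> interior A" and "x \<le> y"
    and dx: "(f has_real_derivative f'x) (at x)" and dy: "(f has_real_derivative f'y) (at y)"
  shows "f'y \<le> f'x"
proof (cases "x = y")
  case True
  then have "f'x = f'y" using DERIV_unique dx dy by blast
  then show ?thesis by simp
next
  case False
  then have "x < y" using \<open>x \<le> y\<close> by simp
  have conv: "convex_on A (\<lambda>t. - f t)"
    using \<open>concave_on A f\<close> by (simp add: concave_on_def)
  have tangent: "- f t - (- f s) \<ge> - D * (t - s)"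
    if "s \<in> interior A" "t \<in> interior A" "(f has_real_derivative D) (at s)" for s t D
  proof (rule convex_on_imp_above_tangent[OF conv \<open>connected A\<close>])
    show "s \<in> interior A" "t \<in> A"
      using that interior_subset[of A] by blast+
    show "((\<lambda>t. - f t) has_real_derivative - D) (at s within A)"
      by (rule DERIV_minus[OF has_field_derivative_at_within[OF that(3)]])
  qed
  from tangent[OF x y dx] tangent[OF y x dy] have "f'y * (y - x) \<le> f'x * (y - x)"
    by (simp add: algebra_simps)
  then show ?thesis using \<open>x < y\<close> by simp
qed

section \<open>Lebesgue norms of continuous functions on an interval\<close>

text \<open>
  The Cauchy-Schwarz inequality against the constant function \<open>1\<close>, proved as the nonnegativity of
  the variance of \<open>f\<close>: integrate \<open>(f - c)\<^sup>2\<close> where \<open>c\<close> is the mean of \<open>f\<close>.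
\<close>
lemma integral_power2_le_length_mult_integral_power2:
  fixes f :: "real \<Rightarrow> real"
  assumes "a \<le> b" and cont: "continuous_on {a..b} f"
  shows "(integral {a..b} f)\<^sup>2 \<le> (b - a) * integral {a..b} (\<lambda>x. (f x)\<^sup>2)"
proof (cases "a = b")
  case True
  then show ?thesis by simp
next
  case False
  then have "a < b" using \<open>a \<le> b\<close> by simp
  define c where "c = integral {a..b} f / (b - a)"
  have i1: "(f has_integral integral {a..b} f) {a..b}"
    using cont by (simp add: integrable_continuous_interval integrable_integral)
  have i2: "((\<lambda>x. (f x)\<^sup>2) has_integral integral {a..b} (\<lambda>x. (f x)\<^sup>2)) {a..b}"
    using cont by (intro integrable_integral integrable_continuous_interval continuous_intros)
  have i0: "((\<lambda>x. c\<^sup>2) has_integral (b - a) * c\<^sup>2) {a..b}"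
    using has_integral_const_real[of "c\<^sup>2" a b] \<open>a < b\<close> by simp
  have "((\<lambda>x. (f x)\<^sup>2 - 2 * c * f x + c\<^sup>2) has_integral
      (integral {a..b} (\<lambda>x. (f x)\<^sup>2) - 2 * c * integral {a..b} f + (b - a) * c\<^sup>2)) {a..b}"
    by (intro has_integral_add has_integral_diff has_integral_mult_right i0 i1 i2)
  then have "0 \<le> integral {a..b} (\<lambda>x. (f x)\<^sup>2) - 2 * c * integral {a..b} f + (b - a) * c\<^sup>2"
  proof (rule has_integral_nonneg)
    fix x
    have "(f x)\<^sup>2 - 2 * c * f x + c\<^sup>2 = (f x - c)\<^sup>2"
      by (simp add: power2_eq_square algebra_simps)
    then show "0 \<le> (f x)\<^sup>2 - 2 * c * f x + c\<^sup>2" by simp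
  qed
  then have "0 \<le> (b - a) *
      (integral {a..b} (\<lambda>x. (f x)\<^sup>2) - 2 * c * integral {a..b} f + (b - a) * c\<^sup>2)"
    using \<open>a < b\<close> by simp
  also have "\<dots> = (b - a) * integral {a..b} (\<lambda>x. (f x)\<^sup>2) - (integral {a..b} f)\<^sup>2"
  proof -
    have I: "integral {a..b} f = c * (b - a)" using \<open>a < b\<close> by (simp add: c_def)
    show ?thesis unfolding I by (simp add: power2_eq_square algebra_simps)
  qed
  finally show ?thesis by simp
qed

lemma Linf_norm_nonneg:
  assumes "continuous_on UNIV f"
  shows "Linf_norm f \<ge> 0"
proof -
  have [measurable]: "f \<in> borel_measurable borel"
    using assms by (rule borel_measurable_continuous_onI)
  have "esssup lborel (\<lambda>x::real. 0::ereal) \<le> esssup lborel (\<lambda>x. ereal (norm (f x)))"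
    by (rule esssup_mono) auto
  then show ?thesis
    by (simp add: Linf_norm_def esssup_const real_of_ereal_pos)
qed

text \<open>
  The bound by the essential supremum holds almost everywhere. For continuous \<open>f\<close> the points where
  it holds form a closed set, and a closed set of full measure is the whole line. Boundedness of
  \<open>f\<close> makes the essential supremum finite, so that its conversion to a real number is not the
  default value \<open>0\<close> for infinity.
\<close>
lemma norm_le_Linf_norm:
  assumes cont: "continuous_on UNIV f" and bdd: "bounded (range f)"
  shows "norm (f x) \<le> Linf_norm f"
proof -
  have [measurable]: "f \<in> borel_measurable borel"
    using cont by (rule borel_measurable_continuous_onI)
  let ?S = "esssup lborel (\<lambda>x. ereal (norm (f x)))"
  obtain B where B: "\<And>x. norm (f x) \<le> B"
    using bdd by (auto simp: bounded_iff)
  have "?S \<le> ereal B"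
    by (rule esssup_I) (use B in auto)
  moreover have "esssup lborel (\<lambda>x::real. 0::ereal) \<le> ?S"
    by (rule esssup_mono) auto
  then have "0 \<le> ?S" by (simp add: esssup_const)
  ultimately have S: "?S = ereal (Linf_norm f)"
    unfolding Linf_norm_def by (cases ?S) auto
  have "AE x in lborel. ereal (norm (f x)) \<le> ?S"
    by (rule esssup_AE)
  then have "AE x in lebesgue. x \<in> {x. norm (f x) \<le> Linf_norm f}"
    unfolding S by (simp add: AE_completion)
  moreover have "closed {x. norm (f x) \<le> Linf_norm f}"
    using cont by (intro closed_Collect_le continuous_intros)
  ultimately have "x \<in> {x. norm (f x) \<le> Linf_norm f}"
    by (intro mem_closed_if_AE_lebesgue)
  then show ?thesis by simp
qed

lemma lebesgue_integral_eq_integral_interval: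
  fixes f :: "real \<Rightarrow> 'a::euclidean_space"
  assumes "continuous_on {a..b} f" and zero: "\<And>x. x \<notin> {a..b} \<Longrightarrow> f x = 0"
  shows "(LINT x|lborel. f x) = integral {a..b} f"
proof -
  have "(LINT x|lborel. f x) = (LINT x:{a..b}|lborel. f x)"
    unfolding set_lebesgue_integral_def
    by (intro Bochner_Integration.integral_cong) (auto simp: zero indicator_def)
  also have "\<dots> = integral {a..b} f"
    using assms(1) by (intro set_borel_integral_eq_integral borel_integrable_atLeastAtMost')
  finally show ?thesis .
qed

lemma L2_norm_nonneg: "L2_norm f \<ge> 0"
  by (simp add: L2_norm_def)

lemma integral_norm_le_L2_norm:
  assumes "a \<le> b" and cont: "continuous_on {a..b} f" and zero: "\<And>x. x \<notin> {a..b} \<Longrightarrow> f x = 0"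
  shows "integral {a..b} (\<lambda>x. norm (f x)) \<le> (b - a) powr (1/2) * L2_norm f"
proof -
  have "(LINT x|lborel. (norm (f x))\<^sup>2) = integral {a..b} (\<lambda>x. (norm (f x))\<^sup>2)"
    by (rule lebesgue_integral_eq_integral_interval)
       (auto intro!: continuous_intros cont simp: zero)
  moreover have "(integral {a..b} (\<lambda>x. norm (f x)))\<^sup>2
      \<le> (b - a) * integral {a..b} (\<lambda>x. (norm (f x))\<^sup>2)"
    by (intro integral_power2_le_length_mult_integral_power2 \<open>a \<le> b\<close> continuous_intros cont)
  ultimately have "integral {a..b} (\<lambda>x. norm (f x)) \<le> sqrt ((b - a) * (LINT x|lborel. (norm (f x))\<^sup>2))"
    by (intro real_le_rsqrt) simp
  then show ?thesis
    using \<open>a \<le> b\<close> by (simp add: L2_norm_def real_sqrt_mult powr_half_sqrt)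
qed

section \<open>Integration by parts against a monotone phase derivative\<close>

text \<open>
  The first-derivative test of van der Corput, with an amplitude that vanishes at the endpoints. The
  amplitude is measured by its sup bound \<open>K\<close> and its total variation; the bound on \<open>\<phi> = \<psi>'\<close> enters
  only through its endpoint values, because \<open>\<phi>\<close> is monotone without zeros.
\<close>
lemma norm_oscillatory_integral_le:
  fixes u u' :: "real \<Rightarrow> complex" and \<psi> \<phi> \<phi>' :: "real \<Rightarrow> real"
  assumes "a \<le> b" and "\<omega> > 0"
    and d\<psi>: "\<And>x. x \<in> {a..b} \<Longrightarrow> (\<psi> has_vector_derivative \<phi> x) (at x within {a..b})"
    and d\<phi>: "\<And>x. x \<in> {a..b} \<Longrightarrow> (\<phi> has_vector_derivative \<phi>' x) (at x within {a..b})"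
    and du: "\<And>x. x \<in> {a..b} \<Longrightarrow> (u has_vector_derivative u' x) (at x within {a..b})"
    and c\<phi>': "continuous_on {a..b} \<phi>'" and cu': "continuous_on {a..b} u'"
    and nz: "\<And>x. x \<in> {a..b} \<Longrightarrow> \<phi> x \<noteq> 0"
    and neg: "\<And>x. x \<in> {a..b} \<Longrightarrow> \<phi>' x \<le> 0"
    and u0: "u a = 0" "u b = 0"
    and K: "\<And>x. x \<in> {a..b} \<Longrightarrow> norm (u x) \<le> K"
  shows "norm (integral {a..b} (\<lambda>x. u x * exp (\<i> * complex_of_real (\<omega> * \<psi> x))))
    \<le> (integral {a..b} (\<lambda>x. norm (u' x)) + K) * inverse (min \<bar>\<phi> a\<bar> \<bar>\<phi> b\<bar>) * inverse \<omega>"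
proof -
  define m where "m = min \<bar>\<phi> a\<bar> \<bar>\<phi> b\<bar>"
  define e where "e x = exp (\<i> * complex_of_real (\<omega> * \<psi> x))" for x
  \<comment> \<open>\<open>F\<close> has derivative \<open>u e + g\<close> and vanishes at the endpoints, so \<open>u e\<close> may be replaced by
    \<open>- g\<close> under the integral; \<open>g\<close> carries the factor \<open>1/\<omega>\<close>.\<close>
  define g where "g x = (u' x * \<phi> x - u x * \<phi>' x) / (\<i> * \<omega> * (\<phi> x)\<^sup>2) * e x" for x
  define F where "F x = u x / (\<i> * \<omega> * \<phi> x) * e x" for x
  have cont: "continuous_on {a..b} \<psi>" "continuous_on {a..b} \<phi>" "continuous_on {a..b} u"
    unfolding continuous_on_eq_continuous_within
    by (blast intro: has_vector_derivative_continuous[OF d\<psi>] has_vector_derivative_continuous[OF d\<phi>]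
        has_vector_derivative_continuous[OF du])+
  have "0 \<le> K" using K[of a] \<open>a \<le> b\<close> norm_ge_zero[of "u a"] by (simp add: u0)
  have m: "m > 0" using nz[of a] nz[of b] \<open>a \<le> b\<close> by (simp add: m_def)
  have mono: "\<phi> y \<le> \<phi> x" if "a \<le> x" "x \<le> y" "y \<le> b" for x y
  proof -
    have "(\<phi>' has_integral \<phi> y - \<phi> x) {x..y}"
      by (rule fundamental_theorem_of_calculus)
         (use that in \<open>auto intro: has_vector_derivative_within_subset[OF d\<phi>]\<close>)
    then have "\<phi> y - \<phi> x \<le> 0"
      by (rule has_integral_le[OF _ has_integral_0]) (use neg that in auto)
    then show ?thesis by simp
  qed
  have sign: "(\<forall>x\<in>{a..b}. \<phi> x > 0) \<or> (\<forall>x\<in>{a..b}. \<phi> x < 0)"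
  proof (rule ccontr)
    assume "\<not> ?thesis"
    then have "\<phi> b < 0" "\<phi> a > 0"
      using mono nz \<open>a \<le> b\<close> by (force simp: not_less)+
    then obtain x where "x \<in> {a..b}" "\<phi> x = 0"
      using IVT2'[of \<phi> b 0 a] \<open>a \<le> b\<close> cont(2) by auto
    then show False using nz by auto
  qed
  have m_le: "m \<le> \<bar>\<phi> x\<bar>" if "x \<in> {a..b}" for x
  proof -
    have "\<phi> b \<le> \<phi> x" "\<phi> x \<le> \<phi> a" using that mono by auto
    moreover have "(\<phi> x > 0 \<and> \<phi> b > 0) \<or> (\<phi> x < 0 \<and> \<phi> a < 0)"
      using sign that \<open>a \<le> b\<close> by auto
    ultimately show ?thesis unfolding m_def by auto
  qed
  \<comment> \<open>The two reciprocals have the same sign, so one of them can be dropped; the other one belongs to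
    the endpoint where \<open>\<bar>\<phi>\<bar>\<close> is smallest: \<open>b\<close> if \<open>\<phi>\<close> is positive, \<open>a\<close> if it is negative.\<close>
  have endpoints: "inverse (\<phi> b) - inverse (\<phi> a) \<le> inverse m"
    using sign
  proof
    assume "\<forall>x\<in>{a..b}. \<phi> x > 0"
    then have "\<phi> a > 0" "\<phi> b > 0"
      using \<open>a \<le> b\<close> by auto
    moreover from this have "m = \<phi> b"
      using mono[of a b] \<open>a \<le> b\<close> by (simp add: m_def)
    ultimately show ?thesis by simp
  next
    assume "\<forall>x\<in>{a..b}. \<phi> x < 0"
    then have "\<phi> a < 0" "\<phi> b < 0"
      using \<open>a \<le> b\<close> by auto
    moreover from this have "m = - \<phi> a"
      using mono[of a b] \<open>a \<le> b\<close> by (simp add: m_def)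
    ultimately show ?thesis by simp
  qed
  have dF: "(F has_vector_derivative (u x * e x + g x)) (at x within {a..b})" if x: "x \<in> {a..b}" for x
  proof -
    have "((\<lambda>x. \<omega> * \<psi> x) has_real_derivative \<omega> * \<phi> x) (at x within {a..b})"
      using d\<psi>[OF x] by (intro DERIV_cmult) (simp add: has_real_derivative_iff_has_vector_derivative)
    then have "((\<lambda>x. \<i> * complex_of_real (\<omega> * \<psi> x)) has_vector_derivative
        \<i> * complex_of_real (\<omega> * \<phi> x)) (at x within {a..b})"
      by (intro has_vector_derivative_mult_right has_vector_derivative_of_real)
    from field_vector_diff_chain_within[OF this DERIV_subset[OF DERIV_exp subset_UNIV]]
    have de: "(e has_vector_derivative \<i> * complex_of_real (\<omega> * \<phi> x) * e x) (at x within {a..b})"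
      by (simp add: e_def[abs_def] o_def)
    have dinv: "((\<lambda>x. inverse (\<phi> x)) has_real_derivative - \<phi>' x / (\<phi> x)\<^sup>2) (at x within {a..b})"
      using d\<phi>[OF x] nz[OF x]
      by (auto simp: has_real_derivative_iff_has_vector_derivative[symmetric]
          power2_eq_square divide_simps intro!: derivative_eq_intros)
    have "((\<lambda>x. complex_of_real (inverse (\<phi> x))) has_vector_derivative of_real (- \<phi>' x / (\<phi> x)\<^sup>2))
        (at x within {a..b})"
      using dinv by (rule has_vector_derivative_of_real)
    note has_vector_derivative_mult[OF has_vector_derivative_mult[OF du[OF x] this]
        has_vector_derivative_mult_right[OF de, of "inverse (\<i> * \<omega>)"]]
    moreover have "F = (\<lambda>x. u x * of_real (inverse (\<phi> x)) * (inverse (\<i> * \<omega>) * e x))"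
      by (simp add: F_def fun_eq_iff field_simps)
    moreover have "u x * of_real (inverse (\<phi> x)) * (inverse (\<i> * \<omega>) * (\<i> * of_real (\<omega> * \<phi> x) * e x)) +
        (u x * of_real (- \<phi>' x / (\<phi> x)\<^sup>2) + u' x * of_real (inverse (\<phi> x))) * (inverse (\<i> * \<omega>) * e x)
        = u x * e x + g x"
      using nz[OF x] \<open>\<omega> > 0\<close> by (simp add: g_def field_simps power2_eq_square)
    ultimately show ?thesis by simp
  qed
  have int1: "((\<lambda>x. u x * e x + g x) has_integral 0) {a..b}"
    using fundamental_theorem_of_calculus[OF \<open>a \<le> b\<close> dF] by (simp add: F_def u0)
  have ig: "g integrable_on {a..b}"
    unfolding g_def e_def using nz \<open>\<omega> > 0\<close>
    by (intro integrable_continuous_interval continuous_intros cont c\<phi>' cu') auto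
  have "((\<lambda>x. (u x * e x + g x) - g x) has_integral (0 - integral {a..b} g)) {a..b}"
    by (intro has_integral_diff int1 integrable_integral ig)
  then have parts: "integral {a..b} (\<lambda>x. u x * e x) = - integral {a..b} g"
    by (simp add: integral_unique)
  have int2: "((\<lambda>x. - \<phi>' x / (\<phi> x)\<^sup>2) has_integral (inverse (\<phi> b) - inverse (\<phi> a))) {a..b}"
  proof (rule fundamental_theorem_of_calculus[OF \<open>a \<le> b\<close>])
    fix x assume "x \<in> {a..b}"
    then show "((\<lambda>x. inverse (\<phi> x)) has_vector_derivative - \<phi>' x / (\<phi> x)\<^sup>2) (at x within {a..b})"
      using d\<phi>[of x] nz[of x]
      by (auto simp: has_real_derivative_iff_has_vector_derivative[symmetric]
          power2_eq_square divide_simps intro!: derivative_eq_intros)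
  qed
  have int3: "((\<lambda>x. norm (u' x)) has_integral integral {a..b} (\<lambda>x. norm (u' x))) {a..b}"
    by (intro integrable_integral integrable_continuous_interval continuous_intros cu')
  have int4: "((\<lambda>x. (inverse m * norm (u' x) + K * (- \<phi>' x / (\<phi> x)\<^sup>2)) * inverse \<omega>) has_integral
      (inverse m * integral {a..b} (\<lambda>x. norm (u' x)) + K * (inverse (\<phi> b) - inverse (\<phi> a))) * inverse \<omega>) {a..b}"
    by (intro has_integral_mult_left has_integral_add has_integral_mult_right int2 int3)
  have bound: "norm (g x) \<le> (inverse m * norm (u' x) + K * (- \<phi>' x / (\<phi> x)\<^sup>2)) * inverse \<omega>"
    if x: "x \<in> {a..b}" for x
  proof -
    have "norm (g x) = norm (u' x * \<phi> x - u x * \<phi>' x) / (\<phi> x)\<^sup>2 * inverse \<omega>"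
      using \<open>\<omega> > 0\<close> by (simp add: g_def e_def norm_mult norm_divide norm_power divide_simps)
    also have "\<dots> \<le> (norm (u' x) * \<bar>\<phi> x\<bar> + norm (u x) * (- \<phi>' x)) / (\<phi> x)\<^sup>2 * inverse \<omega>"
      using neg[OF x] \<open>\<omega> > 0\<close> norm_triangle_ineq4[of "u' x * \<phi> x" "u x * \<phi>' x"]
      by (intro mult_right_mono divide_right_mono) (auto simp: norm_mult)
    also have "\<dots> = (inverse \<bar>\<phi> x\<bar> * norm (u' x) + norm (u x) * (- \<phi>' x / (\<phi> x)\<^sup>2)) * inverse \<omega>"
    proof -
      have "inverse \<bar>\<phi> x\<bar> = \<bar>\<phi> x\<bar> / (\<phi> x)\<^sup>2"
        using nz[OF x] by (cases "\<phi> x > 0") (simp_all add: power2_eq_square field_simps)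
      then show ?thesis by (simp add: add_divide_distrib diff_divide_distrib mult.commute)
    qed
    also have "\<dots> \<le> (inverse m * norm (u' x) + K * (- \<phi>' x / (\<phi> x)\<^sup>2)) * inverse \<omega>"
      using m m_le[OF x] K[OF x] neg[OF x] \<open>\<omega> > 0\<close>
      by (intro mult_right_mono add_mono le_imp_inverse_le) (auto simp: divide_nonpos_nonneg)
    finally show ?thesis .
  qed
  have "norm (integral {a..b} (\<lambda>x. u x * e x)) = norm (integral {a..b} g)"
    by (simp add: parts)
  also have "\<dots> \<le> (inverse m * integral {a..b} (\<lambda>x. norm (u' x)) + K * (inverse (\<phi> b) - inverse (\<phi> a))) * inverse \<omega>"
    using integral_norm_bound_integral[OF ig has_integral_integrable[OF int4] bound]
    unfolding integral_unique[OF int4] .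
  also have "\<dots> \<le> (inverse m * integral {a..b} (\<lambda>x. norm (u' x)) + K * inverse m) * inverse \<omega>"
    using endpoints \<open>0 \<le> K\<close> \<open>\<omega> > 0\<close> by (intro mult_right_mono add_left_mono mult_left_mono) auto
  finally show ?thesis
    unfolding e_def m_def by (simp add: algebra_simps)
qed

section \<open>The estimate on the real line\<close>

theorem theorem2p4:
  fixes p1 p2 pt1 pt2 :: real
    and \<psi> :: "real \<Rightarrow> real"
    and U :: "real \<Rightarrow> complex"
  assumes "{p1..p2} \<subseteq> {pt1<..<pt2}"
    and "C2_function \<psi>"
    and "concave_on UNIV \<psi>"
    and "\<forall>p\<in>{p1..p2}. \<bar>deriv \<psi> p\<bar> > 0"
    and "U C1_differentiable_on UNIV"
    and "closed_support U \<subseteq> {p1..p2}"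
  shows "\<forall>\<omega>::real. \<omega> > 0 \<longrightarrow>
    norm (LINT p|lborel. U p * exp (\<i> * complex_of_real (\<omega> * \<psi> p)))
      \<le> (C3 \<psi> p1 p2 * L2_norm (\<lambda>p. vector_derivative U (at p)) + C4 \<psi> p1 p2 * Linf_norm U)
         * inverse \<omega>"
proof (intro allI impI)
  fix \<omega> :: real assume "\<omega> > 0"
  define \<phi> where "\<phi> = deriv \<psi>"
  define \<phi>' where "\<phi>' p = vector_derivative \<phi> (at p)" for p
  define U' where "U' p = vector_derivative U (at p)" for p
  have d\<psi>: "(\<psi> has_real_derivative \<phi> p) (at p)" for p
    using assms(2) unfolding C2_function_def C1_differentiable_on_def \<phi>_def
    by (metis DERIV_imp_deriv UNIV_I has_real_derivative_iff_has_vector_derivative)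
  have d\<phi>: "(\<phi> has_vector_derivative \<phi>' p) (at p)" for p
    using assms(2) by (simp add: C2_function_def C1_differentiable_on_eq \<phi>_def \<phi>'_def vector_derivative_works)
  have c\<phi>': "continuous_on UNIV \<phi>'"
    using assms(2) by (simp add: C2_function_def C1_differentiable_on_eq \<phi>_def \<phi>'_def[abs_def])
  have dU: "(U has_vector_derivative U' p) (at p)" for p
    using assms(5) by (simp add: C1_differentiable_on_eq U'_def vector_derivative_works)
  have cU': "continuous_on UNIV U'"
    using assms(5) by (simp add: C1_differentiable_on_eq U'_def[abs_def])
  have cU: "continuous_on UNIV U"
    using dU by (meson continuous_at_imp_continuous_on has_vector_derivative_continuous)
  have c\<psi>: "continuous_on UNIV \<psi>"
    using d\<psi> by (meson DERIV_isCont continuous_at_imp_continuous_on)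
  have supp: "U p = 0" if "p \<notin> {p1..p2}" for p
    using assms(6) that closure_subset[of "{x. U x \<noteq> 0}"] by (auto simp: closed_support_def)
  have supp': "U' p = 0" if "p \<notin> {p1..p2}" for p
  proof -
    have "((\<lambda>p. 0) has_vector_derivative U' p) (at p)"
      by (rule has_vector_derivative_transform_within_open[OF dU, where S = "- {p1..p2}"])
         (use that supp in \<open>auto simp: open_Compl\<close>)
    then show ?thesis
      using has_vector_derivative_const vector_derivative_unique_at by blast
  qed
  show "norm (LINT p|lborel. U p * exp (\<i> * complex_of_real (\<omega> * \<psi> p)))
      \<le> (C3 \<psi> p1 p2 * L2_norm (\<lambda>p. vector_derivative U (at p)) + C4 \<psi> p1 p2 * Linf_norm U)
         * inverse \<omega>"
  proof (cases "p1 \<le> p2")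
    case False
    \<comment> \<open>An empty interval forces \<open>U = 0\<close>. The constant in front of the \<open>L\<^sup>2\<close> norm is still
      nonnegative, because \<open>powr\<close> is nonnegative for the negative base \<open>p2 - p1\<close> too.\<close>
    then have "U = (\<lambda>p. 0)" using supp by auto
    moreover have "Linf_norm U \<ge> 0" using cU by (rule Linf_norm_nonneg)
    ultimately show ?thesis
      using \<open>\<omega> > 0\<close> by (simp add: C3_def C4_def L2_norm_nonneg)
  next
    case True
    \<comment> \<open>At the endpoints \<open>U\<close> vanishes as a limit of its values outside the interval.\<close>
    have U1: "U p1 = 0"
    proof -
      have "closure {..<p1} \<subseteq> {p. U p = 0}"
        by (rule closure_minimal)
           (use supp cU in \<open>auto intro!: closed_Collect_eq continuous_intros\<close>)
      then show ?thesis by auto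
    qed
    have U2: "U p2 = 0"
    proof -
      have "closure {p2<..} \<subseteq> {p. U p = 0}"
        by (rule closure_minimal)
           (use supp cU in \<open>auto intro!: closed_Collect_eq continuous_intros\<close>)
      then show ?thesis by auto
    qed
    have "bounded (U ` {p1..p2})"
      by (intro compact_imp_bounded compact_continuous_image continuous_on_subset[OF cU]) auto
    moreover have "range U \<subseteq> insert 0 (U ` {p1..p2})"
      using supp by blast
    ultimately have "bounded (range U)"
      by (meson bounded_insert bounded_subset)
    then have K: "norm (U p) \<le> Linf_norm U" for p
      using cU by (intro norm_le_Linf_norm)
    have "antimono \<phi>"
      by (rule antimonoI, rule concave_on_deriv_antimono[OF assms(3)])
         (auto intro: d\<psi>)
    then have "mono_on UNIV (\<lambda>p. - \<phi> p)"
      by (auto simp: monotone_on_def)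
    moreover have "((\<lambda>p. - \<phi> p) has_real_derivative - \<phi>' p) (at p)" for p
      using d\<phi> by (auto simp: has_real_derivative_iff_has_vector_derivative intro!: derivative_eq_intros)
    ultimately have neg: "\<phi>' p \<le> 0" for p
      using mono_on_imp_deriv_nonneg[of UNIV "\<lambda>p. - \<phi> p" "- \<phi>' p" p] by simp
    let ?M = "inverse (min \<bar>\<phi> p1\<bar> \<bar>\<phi> p2\<bar>)"
    have "(LINT p|lborel. U p * exp (\<i> * complex_of_real (\<omega> * \<psi> p)))
        = integral {p1..p2} (\<lambda>p. U p * exp (\<i> * complex_of_real (\<omega> * \<psi> p)))"
      by (rule lebesgue_integral_eq_integral_interval)
         (auto intro!: continuous_intros continuous_on_subset[OF cU] continuous_on_subset[OF c\<psi>]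
           simp: supp)
    also have "norm \<dots> \<le> (integral {p1..p2} (\<lambda>p. norm (U' p)) + Linf_norm U) * ?M * inverse \<omega>"
    proof (rule norm_oscillatory_integral_le[where \<phi>' = \<phi>', OF True \<open>\<omega> > 0\<close>])
      show "(\<psi> has_vector_derivative \<phi> p) (at p within {p1..p2})" for p
        using d\<psi>[of p] has_vector_derivative_at_within
        by (auto simp: has_real_derivative_iff_has_vector_derivative)
    qed (use d\<phi> dU K U1 U2 neg assms(4) in
        \<open>auto simp: \<phi>_def[symmetric] intro: has_vector_derivative_at_within
          continuous_on_subset[OF c\<phi>'] continuous_on_subset[OF cU']\<close>)
    also have "\<dots> \<le> ((p2 - p1) powr (1/2) * L2_norm U' + Linf_norm U) * ?M * inverse \<omega>"
      using \<open>\<omega> > 0\<close> True supp'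
      by (intro mult_right_mono add_right_mono integral_norm_le_L2_norm continuous_on_subset[OF cU'])
         auto
    also have "\<dots> = (C3 \<psi> p1 p2 * L2_norm U' + C4 \<psi> p1 p2 * Linf_norm U) * inverse \<omega>"
      by (simp add: C3_def C4_def \<phi>_def algebra_simps)
    finally show ?thesis
      by (simp add: U'_def[abs_def])
  qed
qed

end
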